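(* Let $A \subset \mathbb{Z}$ with $|A| < \infty$. Then there exists $\mathcal{A} \in \mathbb{I}$ such that $|A + A| = \mu(\mathcal{A} + \mathcal{A})$ and $|A - A| = \mu(\mathcal{A} - \mathcal{A})$.
   Context: $\mathbb{I}$ denotes the set of all collections of finitely many disjoint (bounded) open intervals on the real line; an element $\mathcal{A} \in \mathbb{I}$ is identified with the subset of $\mathbb{R}$ that is the union of its intervals. (The paper freely replaces open intervals by closed ones, as this does not affect measures.) For a set $X$ of integers or of real numbers, $X + X = \{x_1 + x_2 : x_1, x_2 \in X\}$ and $X - X = \{x_1 - x_2 : x_1, x_2 \in X\}$. $|\cdot|$ is cardinality and $\mu$ is Lebesgue measure on $\mathbb{R}$. *)

theory Defs
  imports "HOL-Analysis.Analysis"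
begin

text \<open>Sums of sets are those of \<^theory>\<open>HOL-Library.Set_Algebras\<close>. In contrast, \<open>X - Y\<close>
  on sets is the set-theoretic complement in Isabelle/HOL, so the pointwise difference
  needs its own name.\<close>

definition difference_set :: "'a::minus set \<Rightarrow> 'a set \<Rightarrow> 'a set"
  where "difference_set X Y = {x - y | x y. x \<in> X \<and> y \<in> Y}"

text \<open>An element of the following set is the collection itself; the subset of the real line
  identified with it is its union. Intervals are taken to be nonempty; the empty
  collection is allowed.\<close>

definition interval_collections :: "real set set set"
  where "interval_collections =
    {\<I>. finite \<I> \<and> (\<forall>I\<in>\<I>. \<exists>a b. a < b \<and> I = {a<..<b}) \<and> disjoint \<I>}"

end

(* Thicken every integer a to the open interval of radius 1/4 around it. The sum and the
   difference of two such intervals are the open intervals of radius 1/2 around a + b and a - b,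
   and those around distinct integers are disjoint of measure 1. *)
theory Submission
  imports Defs
begin

text \<open>The radius is a parameter because adding or subtracting two thickened sets doubles it:
  1/4 serves for the witness, 1/2 for its sum and difference sets.\<close>

definition thicken :: "real \<Rightarrow> int set \<Rightarrow> real set"
  where "thicken r S = (\<Union>n\<in>S. {of_int n - r<..<of_int n + r})"

lemma mem_thicken_iff: "x \<in> thicken r S \<longleftrightarrow> (\<exists>n\<in>S. \<bar>x - of_int n\<bar> < r)"
  by (force simp: thicken_def abs_less_iff)

lemma mem_thickenI: "n \<in> S \<Longrightarrow> \<bar>x - of_int n\<bar> < r \<Longrightarrow> x \<in> thicken r S"
  by (auto simp: mem_thicken_iff)

text \<open>A common point of two intervals puts their centres at distance less than
  \<open>2 * r\<close>, hence less than 1, and integers that close are equal. Radius 1/2 serves for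
  additivity of the measure, radius 1/4 for disjointness of the chosen collection.\<close>

lemma disjoint_family_on_int_intervals:
  assumes "r \<le> 1 / 2"
  shows "disjoint_family_on (\<lambda>n::int. {real_of_int n - r<..<real_of_int n + r}) S"
proof (unfold disjoint_family_on_def, intro ballI impI equals0I)
  fix m n :: int and x :: real
  assume "m \<noteq> n" and x: "x \<in> {real_of_int m - r<..<real_of_int m + r} \<inter>
    {real_of_int n - r<..<real_of_int n + r}"
  have "\<bar>real_of_int m - real_of_int n\<bar> < 1"
    using x assms by auto
  then have "m = n"
    by linarith
  with \<open>m \<noteq> n\<close> show False ..
qed

text \<open>At radius 1/2 the intervals have length exactly 1 and are still disjoint, so the measure
  counts the centres.\<close>

lemma emeasure_thicken_half:
  assumes "finite S"
  shows "emeasure lebesgue (thicken (1 / 2) S) = of_nat (card S)"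
proof -
  have "(\<Sum>n\<in>S. emeasure lebesgue {real_of_int n - 1 / 2<..<real_of_int n + 1 / 2}) =
      emeasure lebesgue (thicken (1 / 2) S)"
    unfolding thicken_def
    by (rule sum_emeasure) (use assms disjoint_family_on_int_intervals[of "1 / 2" S] in auto)
  then show ?thesis
    by simp
qed

text \<open>One inclusion is the triangle inequality; for the other, the offset of \<open>x\<close>
  from \<open>m + n\<close> is shared equally between the two summands.\<close>

lemma thicken_plus: "thicken r S + thicken r T = thicken (2 * r) (S + T)"
proof (intro subset_antisym subsetI)
  fix x assume "x \<in> thicken r S + thicken r T"
  then obtain y z m n where *: "x = y + z" "m \<in> S" "n \<in> T" "\<bar>y - of_int m\<bar> < r" "\<bar>z - of_int n\<bar> < r"
    by (auto simp: set_plus_def mem_thicken_iff)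
  then have "\<bar>x - of_int (m + n)\<bar> < 2 * r"
    by simp
  moreover have "m + n \<in> S + T"
    using *(2,3) by (rule set_plus_intro)
  ultimately show "x \<in> thicken (2 * r) (S + T)"
    by (rule mem_thickenI[rotated])
next
  fix x assume "x \<in> thicken (2 * r) (S + T)"
  then obtain m n where mn: "m \<in> S" "n \<in> T" "\<bar>x - of_int (m + n)\<bar> < 2 * r"
    by (auto simp: mem_thicken_iff set_plus_def)
  \<comment> \<open>Half of the offset: shifting both \<open>m\<close> and \<open>n\<close> by
    \<open>d\<close> recovers \<open>x\<close>, and each shift is smaller than
    \<open>r\<close>.\<close>
  define d where "d = (x - of_int (m + n)) / 2"
  have "\<bar>d\<bar> < r"
    using mn(3) by (simp add: d_def)
  then have "of_int m + d \<in> thicken r S" and "of_int n + d \<in> thicken r T"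
    using mn(1,2) by (auto intro: mem_thickenI[of m] mem_thickenI[of n])
  moreover have "x = (of_int m + d) + (of_int n + d)"
    by (simp add: d_def)
  ultimately show "x \<in> thicken r S + thicken r T"
    by (metis set_plus_intro)
qed

text \<open>The argument for sums carries over because each interval is symmetric about its
  centre.\<close>

lemma thicken_difference:
  "difference_set (thicken r S) (thicken r T) = thicken (2 * r) (difference_set S T)"
proof (intro subset_antisym subsetI)
  fix x assume "x \<in> difference_set (thicken r S) (thicken r T)"
  then obtain y z m n where *: "x = y - z" "m \<in> S" "n \<in> T" "\<bar>y - of_int m\<bar> < r" "\<bar>z - of_int n\<bar> < r"
    by (auto simp: difference_set_def mem_thicken_iff)
  then have "\<bar>x - of_int (m - n)\<bar> < 2 * r"
    by simp
  moreover have "m - n \<in> difference_set S T"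
    using *(2,3) by (auto simp: difference_set_def)
  ultimately show "x \<in> thicken (2 * r) (difference_set S T)"
    by (rule mem_thickenI[rotated])
next
  fix x assume "x \<in> thicken (2 * r) (difference_set S T)"
  then obtain m n where mn: "m \<in> S" "n \<in> T" "\<bar>x - of_int (m - n)\<bar> < 2 * r"
    by (auto simp: mem_thicken_iff difference_set_def)
  \<comment> \<open>The shifts now have opposite signs, \<open>m\<close> moving by \<open>d\<close>
    and \<open>n\<close> by \<open>- d\<close>, so that they add up under subtraction.\<close>
  define d where "d = (x - of_int (m - n)) / 2"
  have "\<bar>d\<bar> < r"
    using mn(3) by (simp add: d_def)
  then have "of_int m + d \<in> thicken r S" and "of_int n - d \<in> thicken r T"
    using mn(1,2) by (auto intro: mem_thickenI[of m] mem_thickenI[of n])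
  moreover have "x = (of_int m + d) - (of_int n - d)"
    by (simp add: d_def)
  ultimately show "x \<in> difference_set (thicken r S) (thicken r T)"
    unfolding difference_set_def by blast
qed

theorem theorem1p1:
  fixes A :: "int set"
  assumes "finite A"
  shows "\<exists>\<A> \<in> interval_collections.
    of_nat (card (A + A)) = emeasure lebesgue (\<Union>\<A> + \<Union>\<A>) \<and>
    of_nat (card (difference_set A A)) = emeasure lebesgue (difference_set (\<Union>\<A>) (\<Union>\<A>))"
proof
  \<comment> \<open>Radius 1/4 is chosen so that its double is the 1/2 of
    \<open>emeasure_thicken_half\<close>.\<close>
  let ?\<A> = "(\<lambda>n. {real_of_int n - 1 / 4<..<real_of_int n + 1 / 4}) ` A"
  have "difference_set A A = (\<lambda>(x, y). x - y) ` (A \<times> A)"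
    by (auto simp: difference_set_def)
  then have "finite (difference_set A A)"
    using assms by simp
  moreover have "finite (A + A)"
    using assms assms by (rule finite_set_plus)
  moreover have "\<Union>?\<A> = thicken (1 / 4) A"
    by (simp add: thicken_def)
  ultimately show "of_nat (card (A + A)) = emeasure lebesgue (\<Union>?\<A> + \<Union>?\<A>) \<and>
      of_nat (card (difference_set A A)) = emeasure lebesgue (difference_set (\<Union>?\<A>) (\<Union>?\<A>))"
    by (simp add: thicken_plus thicken_difference emeasure_thicken_half)
  have "disjoint ?\<A>"
    by (rule disjoint_family_on_disjoint_image, rule disjoint_family_on_int_intervals) simp
  moreover have "\<exists>a b. a < b \<and> I = {a<..<b}" if "I \<in> ?\<A>" for I
  proof -
    from that obtain n where "I = {real_of_int n - 1 / 4<..<real_of_int n + 1 / 4}"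
      by blast
    moreover have "real_of_int n - 1 / 4 < real_of_int n + 1 / 4"
      by simp
    ultimately show ?thesis
      by blast
  qed
  ultimately show "?\<A> \<in> interval_collections"
    using assms unfolding interval_collections_def by blast
qed

end
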